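(* Let $g_1(n)$ and $h_1(n)$ be defined by $$(-q,-q^{4};q^{5})_{\infty}^{2}(q^{4},q^{6};q^{10})_{\infty}=\sum_{n=0}^{\infty}g_{1}(n)q^{n},\qquad (-q^{2},-q^{3};q^{5})_{\infty}^{2}(q^{2},q^{8};q^{10})_{\infty}=\sum_{n=0}^{\infty}h_{1}(n)q^{n}.$$ Then for any integer $n\geq0$, $$g_{1}(5n)=h_{1}(5n)\qquad\text{and}\qquad g_{1}(5n+4)=-h_{1}(5n+4).$$
   Context: Notation: for $|q|<1$, $(a;q)_{\infty}:=\prod_{n=0}^{\infty}(1-aq^{n})$ and $(a_{1},\ldots,a_{m};q)_{\infty}:=(a_{1};q)_{\infty}\cdots(a_{m};q)_{\infty}$; similarly with $q$ replaced by $q^k$ in the base. *)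

theory Defs
  imports "HOL-Analysis.Analysis"
begin

definition qpochhammer_inf :: "complex \<Rightarrow> complex \<Rightarrow> complex" where
  "qpochhammer_inf a q = (\<Prod>n. 1 - a * q ^ n)"

(* The value of prodinf is meaningful only for a convergent product; for |q| < 1 this is
   always the case. *)
lemma convergent_prod_qpochhammer_inf:
  fixes a q :: complex
  assumes "norm q < 1"
  shows "convergent_prod (\<lambda>n. 1 - a * q ^ n)"
proof -
  have "summable (\<lambda>n. norm a * norm q ^ n)"
    using assms by (intro summable_mult summable_geometric) simp
  hence "summable (\<lambda>n. norm ((1 - a * q ^ n) - 1))"
    by (simp add: norm_mult norm_power)
  thus ?thesis
    by (intro abs_convergent_prod_imp_convergent_prod summable_imp_abs_convergent_prod)
qed

definition qpochhammer_inf_list :: "complex list \<Rightarrow> complex \<Rightarrow> complex" where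
  "qpochhammer_inf_list as q = prod_list (map (\<lambda>a. qpochhammer_inf a q) as)"

end

theory Submission
  imports Defs
begin

text \<open>Write \<open>theta p x\<close> for \<open>(x, p/x; p)\<^sub>\<infinity>\<close>, the theta function up to the factor
  \<open>(p; p)\<^sub>\<infinity>\<close>. For \<open>0 < |q| < 1\<close> the two generating functions are
  \<open>G = theta (q^5) (-q)^2 * theta (q^10) (q^4)\<close> and
  \<open>H = theta (q^5) (-q^2)^2 * theta (q^10) (q^2)\<close>. The claim is that \<open>G + H\<close> has no coefficients
  at exponents \<open>4\<close> modulo \<open>5\<close>, and \<open>G - H\<close> none at multiples of \<open>5\<close>.

  Everything is drawn from one identity, Kronecker's expansion of a quotient of theta functions
  (\<open>kronecker_product\<close>), valid for \<open>|p| < |z| < 1\<close>: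
  \<open>(\<Sum>n\<in>\<int>. z^n / (1 - a p^n)) = (p; p)^2 * theta p (a z) / (theta p a * theta p z)\<close>.
  It is the limit of a partial fraction expansion in \<open>a\<close>.

  The even and odd terms of the series are again Kronecker series, to the base \<open>p^2\<close>; comparing
  the product sides gives an addition formula for theta functions (\<open>theta_addition\<close>). Since \<open>G\<close>
  and \<open>H\<close> share the factor \<open>theta (q^5) (-q) * theta (q^5) (-q^2)\<close>, the addition formula turns
  \<open>G + H\<close> and \<open>G - H\<close> into single products, namely \<open>theta (q^10) (q^4) / theta (q^10) q\<close> and
  \<open>q * theta (q^10) (q^2) / theta (q^10) (q^3)\<close> times a function of \<open>q^5\<close>. By Kronecker's
  identity with \<open>p = q^10\<close> and \<open>z = q^5\<close> these are, up to another function of \<open>q^5\<close>, the Kronecker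
  series with \<open>a = q\<close> and \<open>a = q^3\<close> (\<open>G1_H1_kronecker\<close>).

  Because \<open>z\<close> and \<open>p\<close> are functions of \<open>Q = q^5\<close>, expanding
  \<open>1/(1 - y) = (1 + y + y^2 + y^3 + y^4) / (1 - y^5)\<close> in every term splits such a series according
  to residues modulo \<open>5\<close>, and the part belonging to \<open>a^m\<close> is the Kronecker series with base \<open>Q^10\<close>,
  argument \<open>Q^(1 + 2m)\<close> and parameter \<open>Q\<close> or \<open>Q^3\<close>. For \<open>m = 4\<close> respectively \<open>m = 3\<close>, parameter
  times argument equals the base, so that the series contains the factor \<open>theta p p = 0\<close> and
  vanishes. These are exactly the parts with the residues \<open>4\<close> in \<open>G + H\<close> and \<open>1 + 3 * 3 \<equiv> 0\<close> in
  \<open>G - H\<close>. A filter by fifth roots of unity (\<open>coeff_zero_if_residue_class_missing\<close>)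
  transfers this to the coefficients.\<close>

section \<open>A partial fraction expansion\<close>

definition mobius_factor :: "complex \<Rightarrow> complex \<Rightarrow> complex" where
  "mobius_factor z x = (1 - z * x) / (1 - x)"

text \<open>The induction step for partial fractions: multiplying a simple pole at \<open>a = 1/b\<close> by one more
  factor yields simple poles at \<open>1/b\<close> and \<open>1/c\<close> only.\<close>
lemma mobius_factor_times_pole:
  assumes "b \<noteq> c" "b \<noteq> 0" "c \<noteq> 0" "a * b \<noteq> 1" "a * c \<noteq> 1"
  shows "mobius_factor z (a * c) / (1 - a * b) =
     mobius_factor z (c / b) / (1 - a * b) + (1 - z) / ((1 - a * c) * (1 - b / c))"
proof -
  have [simp]: "1 - a * b \<noteq> 0" "1 - a * c \<noteq> 0" "b - c \<noteq> 0" "c - b \<noteq> 0" using assms by auto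
  have e1: "mobius_factor z (c / b) = (b - z * c) / (b - c)"
    using assms by (simp add: mobius_factor_def divide_simps)
  have e2: "1 - b / c = (c - b) / c" using assms by (simp add: divide_simps)
  show ?thesis
    unfolding e1 e2 mobius_factor_def using assms
    apply (simp add: divide_simps)
    apply (simp add: algebra_simps)
    done
qed

text \<open>Both sides are functions of \<open>a\<close> with the same simple poles. In the induction the new factor
  contributes a pole at \<open>1 / b m\<close> whose coefficient is \<open>1 - z\<close> times the value of the old product
  at \<open>a = 1 / b m\<close>; the induction hypothesis is therefore applied both at \<open>a\<close> and at that point.\<close>
lemma partial_fractions:
  fixes b :: "'i \<Rightarrow> complex"
  assumes "finite K" "inj_on b K" "\<And>k. k \<in> K \<Longrightarrow> b k \<noteq> 0" "\<And>k. k \<in> K \<Longrightarrow> a * b k \<noteq> 1"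
  shows "(\<Prod>k\<in>K. mobius_factor z (a * b k)) = z ^ card K +
    (\<Sum>n\<in>K. (1 - z) / (1 - a * b n) * (\<Prod>k\<in>K-{n}. mobius_factor z (b k / b n)))"
  using assms
proof (induction K arbitrary: a rule: finite_induct)
  case empty
  show ?case by simp
next
  case (insert m K)
  define P where "P n = (\<Prod>k\<in>K-{n}. mobius_factor z (b k / b n))" for n
  have ne: "b n \<noteq> b m" "b n \<noteq> 0" "a * b n \<noteq> 1" if "n \<in> K" for n
    using insert that by (auto simp: inj_on_def)
  have m: "b m \<noteq> 0" "a * b m \<noteq> 1" using insert by auto
  have IH1: "(\<Prod>k\<in>K. mobius_factor z (a * b k)) = z ^ card K + (\<Sum>n\<in>K. (1 - z) / (1 - a * b n) * P n)"
    unfolding P_def using insert by (intro insert.IH) (auto simp: inj_on_def)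
  have "(\<Prod>k\<in>K. mobius_factor z (1 / b m * b k)) =
      z ^ card K + (\<Sum>n\<in>K. (1 - z) / (1 - 1 / b m * b n) * P n)"
    unfolding P_def using insert m ne by (intro insert.IH) (auto simp: inj_on_def field_simps)
  hence IH2: "(\<Prod>k\<in>K. mobius_factor z (b k / b m)) = z ^ card K + (\<Sum>n\<in>K. (1 - z) / (1 - b n / b m) * P n)"
    by simp
  have P_ins: "(\<Prod>k\<in>insert m K-{n}. mobius_factor z (b k / b n)) = mobius_factor z (b m / b n) * P n"
    if "n \<in> K" for n
  proof -
    have "insert m K - {n} = insert m (K - {n})" using that insert by auto
    thus ?thesis using insert that by (simp add: P_def)
  qed
  have Pm: "(\<Prod>k\<in>insert m K-{m}. mobius_factor z (b k / b m)) = (\<Prod>k\<in>K. mobius_factor z (b k / b m))"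
    using insert by (intro prod.cong) auto
  have "(\<Prod>k\<in>insert m K. mobius_factor z (a * b k)) =
     mobius_factor z (a * b m) * z ^ card K
     + (\<Sum>n\<in>K. (1 - z) * P n * (mobius_factor z (a * b m) / (1 - a * b n)))"
    using insert by (simp add: IH1 algebra_simps sum_distrib_left)
  also have "(\<Sum>n\<in>K. (1 - z) * P n * (mobius_factor z (a * b m) / (1 - a * b n))) =
     (\<Sum>n\<in>K. (1 - z) * P n * (mobius_factor z (b m / b n) / (1 - a * b n)
        + (1 - z) / ((1 - a * b m) * (1 - b n / b m))))"
    using mobius_factor_times_pole ne m by (intro sum.cong) auto
  also have "\<dots> = (\<Sum>n\<in>K. (1 - z) / (1 - a * b n) * (mobius_factor z (b m / b n) * P n))
     + (1 - z) / (1 - a * b m) * (\<Sum>n\<in>K. (1 - z) / (1 - b n / b m) * P n)"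
    by (simp add: algebra_simps sum.distrib sum_distrib_left)
  also have "mobius_factor z (a * b m) = z + (1 - z) / (1 - a * b m)"
    using m by (simp add: mobius_factor_def field_simps)
  finally have "(\<Prod>k\<in>insert m K. mobius_factor z (a * b k)) = z ^ Suc (card K)
     + (1 - z) / (1 - a * b m) * (\<Prod>k\<in>K. mobius_factor z (b k / b m))
     + (\<Sum>n\<in>K. (1 - z) / (1 - a * b n) * (mobius_factor z (b m / b n) * P n))"
    by (simp add: IH2 algebra_simps)
  thus ?case using insert by (simp add: Pm P_ins)
qed

section \<open>Limits of bilateral series\<close>

text \<open>Dominated convergence for unordered sums, obtained from the integral over the counting measure.\<close>
lemma tannery_infsum:
  fixes f :: "nat \<Rightarrow> 'i \<Rightarrow> complex" and g :: "'i \<Rightarrow> real"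
  assumes g: "g summable_on UNIV"
    and bound: "\<And>N x. norm (f N x) \<le> g x"
    and lim: "\<And>x. (\<lambda>N. f N x) \<longlonglongrightarrow> f' x"
  shows "(\<lambda>N. infsum (f N) UNIV) \<longlonglongrightarrow> infsum f' UNIV"
proof -
  have g0: "g x \<ge> 0" for x using bound[of 0 x] norm_ge_zero order_trans by blast
  have "(\<lambda>x. norm (g x)) summable_on UNIV" using g g0 by (simp add: abs_of_nonneg)
  hence gi: "integrable (count_space UNIV) g"
    unfolding abs_summable_equivalent abs_summable_on_def .
  have conv: "infsum h UNIV = lebesgue_integral (count_space UNIV) h"
    if "\<And>x. norm (h x) \<le> g x" for h :: "'i \<Rightarrow> complex"
  proof -
    have "integrable (count_space UNIV) h"
      using that by (intro Bochner_Integration.integrable_bound[OF gi]) (auto intro: order_trans simp: g0 abs_of_nonneg)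
    hence "Infinite_Set_Sum.abs_summable_on h UNIV" by (simp add: abs_summable_on_def)
    from infsetsum_infsum[OF this] show ?thesis by (simp add: infsetsum_def)
  qed
  have "norm (f' x) \<le> g x" for x
    using lim[of x] bound by (intro LIMSEQ_le_const2[OF tendsto_norm[OF lim[of x]]]) auto
  hence c': "infsum f' UNIV = lebesgue_integral (count_space UNIV) f'" by (rule conv)
  have "(\<lambda>N. lebesgue_integral (count_space UNIV) (f N)) \<longlonglongrightarrow> lebesgue_integral (count_space UNIV) f'"
    using bound lim by (intro integral_dominated_convergence[OF _ _ gi]) auto
  thus ?thesis using bound conv c' by simp
qed

lemma abs_summable_on_int_from_halves:
  fixes f :: "int \<Rightarrow> 'a::real_normed_vector"
  assumes "summable (\<lambda>n. norm (f (int n)))" "summable (\<lambda>n. norm (f (- 1 - int n)))"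
  shows "(\<lambda>n. norm (f n)) summable_on UNIV"
proof -
  have "(\<lambda>n. norm (f n)) summable_on range int"
    using assms(1) by (subst summable_on_reindex) (auto simp: o_def summable_on_UNIV_nonneg_real_iff)
  moreover have "(\<lambda>n. norm (f n)) summable_on range (\<lambda>n. - 1 - int n)"
    using assms(2) by (subst summable_on_reindex) (auto simp: o_def summable_on_UNIV_nonneg_real_iff inj_on_def)
  moreover have "(UNIV :: int set) = range int \<union> range (\<lambda>n. - 1 - int n)"
  proof -
    have "x \<in> range int \<union> range (\<lambda>n. - 1 - int n)" for x
      by (cases "x \<ge> 0") (auto intro: image_eqI[of _ _ "nat x"] image_eqI[of _ _ "nat (-1-x)"])
    thus ?thesis by auto
  qed
  ultimately show ?thesis by (metis summable_on_union)
qed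

section \<open>Theta functions and the Kronecker series\<close>

definition theta :: "complex \<Rightarrow> complex \<Rightarrow> complex" where
  "theta p x = qpochhammer_inf x p * qpochhammer_inf (p / x) p"

definition kronecker_term :: "complex \<Rightarrow> complex \<Rightarrow> complex \<Rightarrow> int \<Rightarrow> complex" where
  "kronecker_term p a z n = z powi n / (1 - a * p powi n)"

definition kronecker_sum :: "complex \<Rightarrow> complex \<Rightarrow> complex \<Rightarrow> complex" where
  "kronecker_sum p a z = (\<Sum>\<^sub>\<infinity>n. kronecker_term p a z n)"

lemma qpochhammer_inf_LIMSEQ:
  assumes "norm q < 1"
  shows "(\<lambda>n. \<Prod>k<n. 1 - a * q ^ k) \<longlonglongrightarrow> qpochhammer_inf a q"
proof -
  have "(\<lambda>n. \<Prod>i<Suc n. 1 - a * q ^ i) \<longlonglongrightarrow> qpochhammer_inf a q"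
    unfolding qpochhammer_inf_def lessThan_Suc_atMost
    by (intro convergent_prod_LIMSEQ convergent_prod_qpochhammer_inf assms)
  thus ?thesis by (rule LIMSEQ_imp_Suc)
qed

lemma qpochhammer_inf_nonzero:
  assumes "norm q < 1" "\<And>n. a * q ^ n \<noteq> 1"
  shows "qpochhammer_inf a q \<noteq> 0"
  unfolding qpochhammer_inf_def using assms
  by (intro prodinf_nonzero convergent_prod_qpochhammer_inf) auto

text \<open>The condition \<open>norm p < norm z\<close> is what makes the negative half converge: there the denominator
  grows like \<open>p^(-m)\<close>, leaving terms of size \<open>(p/z)^m\<close>.\<close>
lemma kronecker_term_summable:
  assumes p: "p \<noteq> 0" "norm p < 1" and z: "norm p < norm z" "norm z < 1"
    and a: "a \<noteq> 0" "\<And>n::int. a * p powi n \<noteq> 1"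
  shows "(\<lambda>n. norm (kronecker_term p a z n)) summable_on UNIV"
proof (rule abs_summable_on_int_from_halves)
  have p0: "(\<lambda>n. p ^ n) \<longlonglongrightarrow> 0" using p by (intro LIMSEQ_power_zero) auto
  have z0: "z \<noteq> 0" using z by auto
  have "(\<lambda>n. 1 / (1 - a * p ^ n)) \<longlonglongrightarrow> 1 / (1 - a * 0)"
    by (intro tendsto_intros p0) auto
  then obtain C where C: "\<And>n. norm (1 / (1 - a * p ^ n)) \<le> C"
    by (metis (no_types, lifting) BseqE convergentI convergent_imp_Bseq)
  show "summable (\<lambda>n. norm (kronecker_term p a z (int n)))"
  proof (rule summable_comparison_test')
    show "summable (\<lambda>n. norm z ^ n * C)" using z by (intro summable_mult2 summable_geometric) auto
    show "norm (norm (kronecker_term p a z (int n))) \<le> norm z ^ n * C" for n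
      using mult_left_mono[OF C[of n], of "norm z ^ n"]
      by (simp add: kronecker_term_def norm_divide norm_mult norm_power)
  qed
  have "(\<lambda>n. 1 / (p ^ n * p - a)) \<longlonglongrightarrow> 1 / (0 * p - a)"
    using a by (intro tendsto_intros p0) auto
  then obtain C where C: "\<And>n. norm (1 / (p ^ n * p - a)) \<le> C"
    by (metis (no_types, lifting) BseqE convergentI convergent_imp_Bseq)
  show "summable (\<lambda>n. norm (kronecker_term p a z (- 1 - int n)))"
  proof (rule summable_comparison_test')
    show "summable (\<lambda>n. norm (p/z) ^ n * (norm (p/z) * C))"
      using z z0 by (intro summable_mult2 summable_geometric) (auto simp: norm_divide)
    show "norm (norm (kronecker_term p a z (- 1 - int n))) \<le> norm (p/z) ^ n * (norm (p/z) * C)" for n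
    proof -
      have e: "w powi (- 1 - int n) = 1 / (w ^ n * w)" if "w \<noteq> 0" for w :: complex
        using that by (simp add: power_int_diff power_int_minus field_simps)
      have d: "p ^ n * p - a \<noteq> 0"
        using a(2)[of "- 1 - int n"] p by (auto simp: e field_simps)
      have "kronecker_term p a z (- 1 - int n) = (p/z) ^ n * (p/z) * (1 / (p ^ n * p - a))"
        using p z0 d by (simp add: kronecker_term_def e divide_simps)
      hence "norm (kronecker_term p a z (- 1 - int n)) =
          norm (p/z) ^ n * (norm (p/z) * norm (1 / (p ^ n * p - a)))"
        by (simp only: norm_mult norm_power mult.assoc)
      also have "\<dots> \<le> norm (p/z) ^ n * (norm (p/z) * C)"
        by (intro mult_left_mono C) auto
      finally show ?thesis by simp
    qed
  qed
qed

section \<open>Kronecker expansion of a theta quotient\<close>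

lemma prod_symmetric_int_interval:
  fixes f :: "int \<Rightarrow> 'a::comm_monoid_mult"
  shows "(\<Prod>k\<in>{- int N..<int N}. f k) = (\<Prod>k<N. f (int k)) * (\<Prod>k<N. f (- 1 - int k))"
proof -
  have "{- int N..<int N} = {0..<int N} \<union> {- int N..<0}" by auto
  hence "(\<Prod>k\<in>{- int N..<int N}. f k) = (\<Prod>k\<in>{0..<int N}. f k) * (\<Prod>k\<in>{- int N..<0}. f k)"
    by (simp add: prod.union_disjoint)
  also have "(\<Prod>k\<in>{0..<int N}. f k) = (\<Prod>k<N. f (int k))"
    by (rule prod.reindex_bij_witness[of _ int nat]) auto
  also have "(\<Prod>k\<in>{- int N..<0}. f k) = (\<Prod>k<N. f (- 1 - int k))"
    by (rule prod.reindex_bij_witness[of _ "\<lambda>k. - 1 - int k" "\<lambda>k. nat (- 1 - k)"]) auto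
  finally show ?thesis .
qed

lemma power_int_negative_nat:
  fixes w :: complex
  assumes "w \<noteq> 0"
  shows "w powi (- 1 - int n) = 1 / w ^ Suc n"
  using assms by (simp add: power_int_diff power_int_minus field_simps)

lemma norm_power_lt_one:
  fixes q :: complex
  assumes "norm q < 1" "0 < n"
  shows "norm (q ^ n) < 1"
  using assms by (simp add: norm_power power_less_one_iff)

lemma norm_power_strict_decreasing:
  fixes q :: complex
  assumes "q \<noteq> 0" "norm q < 1" "m < n"
  shows "norm (q ^ n) < norm (q ^ m)"
  unfolding norm_power using assms by (intro power_strict_decreasing) auto

lemma power_eq_one_imp_zero:
  fixes p :: complex
  assumes "norm p < 1" "p ^ n = 1"
  shows "n = 0"
proof (rule ccontr)
  assume "n \<noteq> 0"
  hence "norm p ^ n < 1" using assms by (simp add: power_less_one_iff)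
  thus False using assms by (metis norm_one norm_power less_irrefl)
qed

lemma power_int_eq_one_imp_zero:
  fixes p :: complex
  assumes "p \<noteq> 0" "norm p < 1" "p powi n = 1"
  shows "n = 0"
proof (cases "n \<ge> 0")
  case True
  thus ?thesis using power_eq_one_imp_zero[of p "nat n"] assms by (simp add: power_int_def)
next
  case False
  hence "p ^ nat (-n) = 1" using assms by (simp add: power_int_def field_simps)
  thus ?thesis using power_eq_one_imp_zero[of p "nat (-n)"] assms False by simp
qed

lemma power_int_progression_ne_one:
  fixes q :: complex
  assumes "q \<noteq> 0" "norm q < 1" "\<not> k dvd i"
  shows "q ^ i * (q ^ k) powi n \<noteq> 1"
proof
  assume "q ^ i * (q ^ k) powi n = 1"
  hence "q powi (int i + int k * n) = 1"
    using assms by (simp add: power_int_add power_int_mult)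
  hence "int i = int k * (- n)" using power_int_eq_one_imp_zero[OF assms(1,2)] by fastforce
  hence "int k dvd int i" by (rule dvdI)
  thus False using assms by simp
qed

text \<open>Pulls out the factor \<open>z\<close> that a node with negative exponent contributes, leaving a quotient that
  tends to \<open>1\<close> as \<open>x\<close> tends to \<open>0\<close>.\<close>
lemma mobius_factor_reflect:
  assumes "x \<noteq> 0" "z \<noteq> 0" "x \<noteq> 1"
  shows "mobius_factor z (1 / x) = z * ((1 - x / z) / (1 - x))"
  using assms by (simp add: mobius_factor_def divide_simps) (simp add: algebra_simps)

text \<open>The residues of the truncated product. The nodes above \<open>n\<close> give a partial product of
  \<open>(zp; p) / (p; p)\<close>, those below \<open>n\<close> one of \<open>(p/z; p) / (p; p)\<close> together with the power of \<open>z\<close> that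
  becomes the numerator of the Kronecker series.\<close>
lemma prod_mobius_factor_punctured:
  assumes p: "p \<noteq> 0" "norm p < 1" and z: "z \<noteq> 0" and n: "n \<in> {- int N..<int N}"
  shows "(\<Prod>k\<in>{- int N..<int N} - {n}. mobius_factor z (p powi k / p powi n)) =
     (\<Prod>j<nat (int N - 1 - n). mobius_factor z (p ^ Suc j)) *
     (z ^ N * z powi n * (\<Prod>j<nat (int N + n). (1 - p ^ Suc j / z) / (1 - p ^ Suc j)))"
proof -
  let ?f = "\<lambda>k. mobius_factor z (p powi k / p powi n)"
  have ratio: "p powi (n + m) / p powi n = p powi m" for m
    using p by (simp add: power_int_add)
  have "{- int N..<int N} - {n} = {n+1..<int N} \<union> {- int N..<n}" using n by auto
  hence "prod ?f ({- int N..<int N} - {n}) = prod ?f {n+1..<int N} * prod ?f {- int N..<n}"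
    by (simp add: prod.union_disjoint)
  also have "prod ?f {n+1..<int N} = (\<Prod>j<nat (int N - 1 - n). mobius_factor z (p ^ Suc j))"
  proof (rule prod.reindex_bij_witness[of _ "\<lambda>j. n + int (Suc j)" "\<lambda>k. nat (k - n - 1)"])
    fix k assume k: "k \<in> {n+1..<int N}"
    hence "k = n + int (Suc (nat (k - n - 1)))" by auto
    thus "mobius_factor z (p ^ Suc (nat (k - n - 1))) = ?f k"
      by (metis ratio power_int_of_nat)
  qed auto
  also have "prod ?f {- int N..<n} =
      (\<Prod>j<nat (int N + n). z * ((1 - p ^ Suc j / z) / (1 - p ^ Suc j)))"
  proof (rule prod.reindex_bij_witness[of _ "\<lambda>j. n + (- 1 - int j)" "\<lambda>k. nat (n - 1 - k)"])
    fix k assume k: "k \<in> {- int N..<n}"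
    define j where "j = nat (n - 1 - k)"
    have kj: "k = n + (- 1 - int j)" using k by (auto simp: j_def)
    have "p ^ Suc j \<noteq> 1" using power_eq_one_imp_zero[OF p(2), of "Suc j"] by blast
    hence "mobius_factor z (1 / p ^ Suc j) = z * ((1 - p ^ Suc j / z) / (1 - p ^ Suc j))"
      using p z by (intro mobius_factor_reflect) auto
    moreover have "p powi k / p powi n = 1 / p ^ Suc j"
      unfolding kj ratio by (rule power_int_negative_nat[OF p(1)])
    ultimately show "z * ((1 - p ^ Suc (nat (n - 1 - k)) / z) / (1 - p ^ Suc (nat (n - 1 - k)))) = ?f k"
      by (simp add: j_def)
  qed auto
  also have "\<dots> = z ^ nat (int N + n) * (\<Prod>j<nat (int N + n). (1 - p ^ Suc j / z) / (1 - p ^ Suc j))"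
    by (simp only: prod.distrib prod_constant card_lessThan)
  also have "z ^ nat (int N + n) = z powi (int N + n)"
    using n by (simp add: power_int_nonneg_exp)
  also have "\<dots> = z ^ N * z powi n" using z by (simp add: power_int_add)
  finally show ?thesis .
qed

text \<open>Take partial fractions with the nodes \<open>p^k\<close>, \<open>-N \<le> k < N\<close>, and divide by \<open>z^N\<close>. The left-hand
  side becomes the truncation \<open>T N\<close> of \<open>theta p (a z) / theta p a\<close>; the constant term becomes
  \<open>z^N\<close>, which tends to \<open>0\<close>; and the term with index \<open>n\<close> is the Kronecker term times two truncated
  products \<open>U\<close> and \<open>V\<close>. As \<open>U\<close> and \<open>V\<close> converge, they are bounded, so the limit may be taken
  termwise, and the product of their limits is \<open>theta p z / (p; p)^2\<close>.\<close>
theorem kronecker_product: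
  assumes p: "p \<noteq> 0" "norm p < 1" and z: "norm p < norm z" "norm z < 1"
    and a: "a \<noteq> 0" "\<And>n::int. a * p powi n \<noteq> 1"
  shows "kronecker_sum p a z * theta p a * theta p z = (qpochhammer_inf p p)\<^sup>2 * theta p (a * z)"
proof -
  have z0: "z \<noteq> 0" using z by auto
  have pSuc: "p ^ Suc j \<noteq> 1" for j using power_eq_one_imp_zero[OF p(2), of "Suc j"] by blast
  have a_neg: "p / a * p ^ j \<noteq> 1" for j
    using a(2)[of "- 1 - int j"] p a(1) by (simp add: power_int_negative_nat[OF p(1)] field_simps)
  have a_pos: "a * p ^ j \<noteq> 1" for j using a(2)[of "int j"] by simp
  have pp0: "qpochhammer_inf p p \<noteq> 0"
    using pSuc by (intro qpochhammer_inf_nonzero p) simp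
  have th_a: "theta p a \<noteq> 0"
    unfolding theta_def using a_pos a_neg by (simp add: qpochhammer_inf_nonzero p)

  define U where "U m = (1 - z) * (\<Prod>j<m. mobius_factor z (p ^ Suc j))" for m
  define V where "V m = (\<Prod>j<m. (1 - p ^ Suc j / z) / (1 - p ^ Suc j))" for m
  let ?u = "qpochhammer_inf z p / qpochhammer_inf p p"
  let ?v = "qpochhammer_inf (p / z) p / qpochhammer_inf p p"
  have "U m = (\<Prod>k<Suc m. 1 - z * p ^ k) / (\<Prod>k<m. 1 - p * p ^ k)" for m
    unfolding U_def mobius_factor_def prod_dividef
    by (subst prod.lessThan_Suc_shift) simp
  moreover have "(\<lambda>m. (\<Prod>k<Suc m. 1 - z * p ^ k) / (\<Prod>k<m. 1 - p * p ^ k)) \<longlonglongrightarrow> ?u"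
    using p pp0 by (intro tendsto_divide LIMSEQ_Suc qpochhammer_inf_LIMSEQ) auto
  ultimately have U: "U \<longlonglongrightarrow> ?u" by presburger
  have "V m = (\<Prod>k<m. 1 - (p / z) * p ^ k) / (\<Prod>k<m. 1 - p * p ^ k)" for m
    unfolding V_def prod_dividef by simp
  moreover have "(\<lambda>m. (\<Prod>k<m. 1 - (p / z) * p ^ k) / (\<Prod>k<m. 1 - p * p ^ k)) \<longlonglongrightarrow> ?v"
    using p pp0 by (intro tendsto_divide qpochhammer_inf_LIMSEQ) auto
  ultimately have V: "V \<longlonglongrightarrow> ?v" by presburger
  obtain A where A: "\<And>m. norm (U m) \<le> A"
    using convergent_imp_Bseq[OF convergentI[OF U]] by (metis BseqE)
  obtain B where B: "\<And>m. norm (V m) \<le> B"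
    using convergent_imp_Bseq[OF convergentI[OF V]] by (metis BseqE)
  have A0: "A \<ge> 0" using A[of 0] norm_ge_zero order_trans by blast

  define t where "t N n = (if n \<in> {- int N..<int N}
      then kronecker_term p a z n * (U (nat (int N - 1 - n)) * V (nat (int N + n))) else 0)" for N n
  define T where "T N = ((\<Prod>k<N. 1 - a * z * p ^ k) * (\<Prod>k<N. 1 - p / (a * z) * p ^ k)) /
     ((\<Prod>k<N. 1 - a * p ^ k) * (\<Prod>k<N. 1 - p / a * p ^ k))" for N

  have finite_identity: "T N = z ^ N + infsum (t N) UNIV" for N
  proof -
    let ?K = "{- int N..<int N}"
    have inj: "inj_on (\<lambda>k. p powi k) ?K"
    proof (rule inj_onI)
      fix x y assume "p powi x = p powi y"
      hence "p powi (x - y) = 1" using p by (simp add: power_int_diff)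
      thus "x = y" using power_int_eq_one_imp_zero[OF p, of "x - y"] by simp
    qed
    have "(\<Prod>k\<in>?K. mobius_factor z (a * p powi k)) = z ^ card ?K + (\<Sum>n\<in>?K. (1 - z) / (1 - a * p powi n) *
        (\<Prod>k\<in>?K-{n}. mobius_factor z (p powi k / p powi n)))"
      by (rule partial_fractions) (use inj p a in auto)
    also have "(\<Sum>n\<in>?K. (1 - z) / (1 - a * p powi n) * (\<Prod>k\<in>?K-{n}. mobius_factor z (p powi k / p powi n)))
       = (\<Sum>n\<in>?K. z ^ N * t N n)"
    proof (rule sum.cong)
      fix n assume n: "n \<in> ?K"
      show "(1 - z) / (1 - a * p powi n) * (\<Prod>k\<in>?K-{n}. mobius_factor z (p powi k / p powi n)) = z ^ N * t N n"
        unfolding prod_mobius_factor_punctured[OF p z0 n] using n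
        by (simp add: t_def kronecker_term_def U_def V_def del: power_Suc)
    qed simp
    also have "\<dots> = z ^ N * infsum (t N) UNIV"
    proof -
      have "infsum (t N) UNIV = infsum (t N) ?K"
        by (rule infsum_cong_neutral) (auto simp: t_def)
      thus ?thesis by (simp add: sum_distrib_left)
    qed
    also have "card ?K = N + N" by simp
    also have "(\<Prod>k\<in>?K. mobius_factor z (a * p powi k)) = z ^ N * T N"
    proof -
      have "mobius_factor z (a * p powi (- 1 - int k)) =
          z * ((1 - p / (a * z) * p ^ k) / (1 - p / a * p ^ k))" for k
      proof -
        have "a * p powi (- 1 - int k) = 1 / (p / a * p ^ k)"
          using a p by (simp add: power_int_negative_nat[OF p(1)])
        moreover have "mobius_factor z (1 / (p / a * p ^ k)) =
            z * ((1 - p / a * p ^ k / z) / (1 - p / a * p ^ k))"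
          using p a z0 a_neg by (intro mobius_factor_reflect) auto
        ultimately show ?thesis by (simp add: field_simps)
      qed
      thus ?thesis
        unfolding prod_symmetric_int_interval
        by (simp only: T_def mobius_factor_def prod.distrib prod_dividef power_int_of_nat
            prod_constant card_lessThan mult_ac times_divide_times_eq times_divide_eq_right
            divide_divide_eq_left)
    qed
    finally have "z ^ N * T N = z ^ N * (z ^ N + infsum (t N) UNIV)"
      by (simp add: power_add algebra_simps)
    thus ?thesis using z0 by simp
  qed

  have "(\<lambda>N. infsum (t N) UNIV) \<longlonglongrightarrow> infsum (\<lambda>n. kronecker_term p a z n * (?u * ?v)) UNIV"
  proof (rule tannery_infsum)
    show "(\<lambda>n. norm (kronecker_term p a z n) * (A * B)) summable_on UNIV"
      using kronecker_term_summable[OF p z a] by (rule summable_on_cmult_left)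
    fix N and n :: int
    show "norm (t N n) \<le> norm (kronecker_term p a z n) * (A * B)"
    proof (cases "n \<in> {- int N..<int N}")
      case True
      have "norm (U (nat (int N - 1 - n)) * V (nat (int N + n))) \<le> A * B"
        unfolding norm_mult using A B A0 by (intro mult_mono) auto
      thus ?thesis unfolding t_def if_P[OF True] norm_mult[of "kronecker_term p a z n"]
        by (intro mult_left_mono) auto
    next
      case False
      have "B \<ge> 0" using B[of 0] norm_ge_zero order_trans by blast
      thus ?thesis unfolding t_def if_not_P[OF False] using A0 by simp
    qed
  next
    fix n :: int
    have lim1: "filterlim (\<lambda>N. nat (int N - 1 - n)) at_top sequentially"
      unfolding filterlim_at_top_ge[of _ _ 0]
    proof safe
      fix Z :: nat
      show "\<forall>\<^sub>F N in sequentially. Z \<le> nat (int N - 1 - n)"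
        using eventually_ge_at_top[of "nat (int Z + 1 + n)"] by eventually_elim auto
    qed
    have lim2: "filterlim (\<lambda>N. nat (int N + n)) at_top sequentially"
      unfolding filterlim_at_top_ge[of _ _ 0]
    proof safe
      fix Z :: nat
      show "\<forall>\<^sub>F N in sequentially. Z \<le> nat (int N + n)"
        using eventually_ge_at_top[of "nat (int Z - n)"] by eventually_elim auto
    qed
    have "(\<lambda>N. kronecker_term p a z n * (U (nat (int N - 1 - n)) * V (nat (int N + n))))
       \<longlonglongrightarrow> kronecker_term p a z n * (?u * ?v)"
      by (intro tendsto_mult tendsto_const filterlim_compose[OF U lim1] filterlim_compose[OF V lim2])
    moreover have "\<forall>\<^sub>F N in sequentially.
        kronecker_term p a z n * (U (nat (int N - 1 - n)) * V (nat (int N + n))) = t N n"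
      using eventually_ge_at_top[of "nat (\<bar>n\<bar> + 1)"] by eventually_elim (auto simp: t_def)
    ultimately show "(\<lambda>N. t N n) \<longlonglongrightarrow> kronecker_term p a z n * (?u * ?v)"
      by (rule Lim_transform_eventually)
  qed
  moreover have "(\<lambda>N. z ^ N) \<longlonglongrightarrow> 0" using z by (intro LIMSEQ_power_zero) auto
  ultimately have "T \<longlonglongrightarrow> 0 + infsum (\<lambda>n. kronecker_term p a z n * (?u * ?v)) UNIV"
    unfolding finite_identity[abs_def] by (intro tendsto_add)
  moreover have "T \<longlonglongrightarrow> theta p (a * z) / theta p a"
    unfolding T_def[abs_def] theta_def using p th_a
    by (intro tendsto_divide tendsto_mult qpochhammer_inf_LIMSEQ) (auto simp: theta_def)
  ultimately have "theta p (a * z) / theta p a = infsum (\<lambda>n. kronecker_term p a z n * (?u * ?v)) UNIV"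
    using LIMSEQ_unique by fastforce
  also have "\<dots> = kronecker_sum p a z * (?u * ?v)"
    unfolding kronecker_sum_def by (rule infsum_cmult_left')
  also have "?u * ?v = theta p z / (qpochhammer_inf p p)\<^sup>2"
    by (simp add: theta_def power2_eq_square)
  finally show ?thesis using th_a pp0 by (simp add: field_simps)
qed

section \<open>Elementary theta relations\<close>

lemma qpochhammer_inf_even_odd:
  assumes q: "norm q < 1"
  shows "qpochhammer_inf a q = qpochhammer_inf a (q\<^sup>2) * qpochhammer_inf (a * q) (q\<^sup>2)"
proof -
  have q2: "norm (q\<^sup>2) < 1" using q by (simp add: norm_power power_less_one_iff)
  have e: "(\<Prod>k<2*N. 1 - a * q ^ k) = (\<Prod>k<N. 1 - a * (q\<^sup>2) ^ k) * (\<Prod>k<N. 1 - a * q * (q\<^sup>2) ^ k)" for N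
  proof (induction N)
    case (Suc N)
    have "q ^ (2 * N) = (q\<^sup>2) ^ N" by (rule power_mult)
    thus ?case using Suc by (simp add: mult_ac)
  qed simp
  have "(\<lambda>N. \<Prod>k<2*N. 1 - a * q ^ k) \<longlonglongrightarrow> qpochhammer_inf a q"
    using LIMSEQ_subseq_LIMSEQ[OF qpochhammer_inf_LIMSEQ[OF q], of "\<lambda>N. 2 * N" a]
    by (simp add: strict_mono_def o_def)
  moreover have "(\<lambda>N. \<Prod>k<2*N. 1 - a * q ^ k) \<longlonglongrightarrow>
      qpochhammer_inf a (q\<^sup>2) * qpochhammer_inf (a * q) (q\<^sup>2)"
    unfolding e by (intro tendsto_mult qpochhammer_inf_LIMSEQ q2)
  ultimately show ?thesis using LIMSEQ_unique by blast
qed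

lemma qpochhammer_inf_mult_minus:
  assumes q: "norm q < 1"
  shows "qpochhammer_inf a q * qpochhammer_inf (- a) q = qpochhammer_inf (a\<^sup>2) (q\<^sup>2)"
proof -
  have q2: "norm (q\<^sup>2) < 1" using q by (simp add: norm_power power_less_one_iff)
  have e: "(\<Prod>k<N. 1 - a\<^sup>2 * (q\<^sup>2) ^ k) = (\<Prod>k<N. 1 - a * q ^ k) * (\<Prod>k<N. 1 - - a * q ^ k)" for N
    unfolding prod.distrib[symmetric]
    by (intro prod.cong refl)
      (simp add: power2_eq_square power_mult_distrib algebra_simps)
  have "(\<lambda>N. \<Prod>k<N. 1 - a\<^sup>2 * (q\<^sup>2) ^ k) \<longlonglongrightarrow> qpochhammer_inf a q * qpochhammer_inf (- a) q"
    unfolding e by (intro tendsto_mult qpochhammer_inf_LIMSEQ q)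
  thus ?thesis using qpochhammer_inf_LIMSEQ[OF q2] LIMSEQ_unique by blast
qed

lemma theta_even_odd:
  assumes "p \<noteq> 0" "norm p < 1"
  shows "theta p x = theta (p\<^sup>2) x * theta (p\<^sup>2) (p * x)"
proof -
  have e: "p\<^sup>2 / (p * x) = p / x" "p / x * p = p\<^sup>2 / x" "x * p = p * x"
    using assms by (simp_all add: power2_eq_square)
  show ?thesis unfolding theta_def e
    using qpochhammer_inf_even_odd[OF assms(2), of x, unfolded e]
      qpochhammer_inf_even_odd[OF assms(2), of "p / x", unfolded e]
    by (simp add: mult_ac)
qed

lemma theta_mult_minus:
  assumes "norm p < 1"
  shows "theta p x * theta p (- x) = theta (p\<^sup>2) (x\<^sup>2)"
  unfolding theta_def
  using qpochhammer_inf_mult_minus[OF assms, of x] qpochhammer_inf_mult_minus[OF assms, of "p / x"]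
  by (simp add: power_divide mult.commute mult.left_commute)

lemma theta_reflect:
  assumes "p \<noteq> 0" "x * y = p"
  shows "theta p x = theta p y"
proof -
  have "p / x = y" "p / y = x" using assms by auto
  thus ?thesis by (simp add: theta_def mult.commute)
qed

lemma theta_self:
  assumes "p \<noteq> 0" "norm p < 1"
  shows "theta p p = 0"
proof -
  have "(\<Prod>k<Suc n. 1 - p / p * p ^ k) = 0" for n
    using assms by (subst prod.lessThan_Suc_shift) simp
  moreover have "(\<lambda>n. \<Prod>k<Suc n. 1 - p / p * p ^ k) \<longlonglongrightarrow> qpochhammer_inf (p / p) p"
    by (intro LIMSEQ_Suc qpochhammer_inf_LIMSEQ assms)
  ultimately have "(\<lambda>n. 0) \<longlonglongrightarrow> qpochhammer_inf (p / p) p" by presburger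
  hence "qpochhammer_inf (p / p) p = 0" using LIMSEQ_const_iff[of "0::complex"] by metis
  thus ?thesis by (simp add: theta_def)
qed

lemma theta_nonzero:
  assumes p: "p \<noteq> 0" "norm p < 1" and x: "norm p < norm x" "norm x < 1"
  shows "theta p x \<noteq> 0"
proof -
  have *: "y * p ^ n \<noteq> 1" if "norm y < 1" for y n
  proof
    assume "y * p ^ n = 1"
    hence "norm y * norm p ^ n = 1" by (metis norm_mult norm_one norm_power)
    moreover have "norm y * norm p ^ n \<le> norm y * 1"
      using p by (intro mult_left_mono power_le_one) auto
    ultimately show False using that by simp
  qed
  have "x \<noteq> 0" using x by auto
  hence "norm (p / x) < 1" using x by (simp add: norm_divide)
  hence "qpochhammer_inf (p / x) p \<noteq> 0" by (intro qpochhammer_inf_nonzero p *)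
  moreover have "qpochhammer_inf x p \<noteq> 0" by (intro qpochhammer_inf_nonzero p * x)
  ultimately show ?thesis by (simp add: theta_def)
qed

section \<open>The addition formula\<close>

text \<open>Replacing \<open>z\<close> by \<open>-z\<close> changes the sign of the odd terms, so the sum and the difference single out
  the even and the odd indices, and \<open>(p^2, z^2)\<close> takes the place of \<open>(p, z)\<close>.\<close>
lemma kronecker_sum_parity:
  assumes p: "p \<noteq> 0" "norm p < 1" and z: "norm p < norm z" "norm z < 1"
    and a: "a \<noteq> 0" "\<And>n::int. a * p powi n \<noteq> 1"
  shows "kronecker_sum p a z + kronecker_sum p a (- z) = 2 * kronecker_sum (p\<^sup>2) a (z\<^sup>2)"
    and "kronecker_sum p a z - kronecker_sum p a (- z) = 2 * z * kronecker_sum (p\<^sup>2) (a * p) (z\<^sup>2)"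
proof -
  have z0: "z \<noteq> 0" using z by auto
  have neg: "kronecker_term p a (- z) n = (if even n then 1 else - 1) * kronecker_term p a z n" for n
    by (auto simp: kronecker_term_def power_int_minus_left)
  have s1: "kronecker_term p a z summable_on UNIV"
    by (rule abs_summable_summable[OF kronecker_term_summable]) (use p z a in auto)
  have s2: "kronecker_term p a (- z) summable_on UNIV"
    by (rule abs_summable_summable[OF kronecker_term_summable]) (use p z a in auto)
  have "kronecker_sum p a z + kronecker_sum p a (- z) =
      infsum (\<lambda>n. kronecker_term p a z n + kronecker_term p a (- z) n) UNIV"
    unfolding kronecker_sum_def by (intro infsum_add[symmetric] s1 s2)
  also have "\<dots> = infsum (\<lambda>n. 2 * kronecker_term p a z n) (range (\<lambda>m. 2 * m))"
    by (intro infsum_cong_neutral) (auto simp: neg elim!: evenE)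
  also have "\<dots> = infsum (\<lambda>m. 2 * kronecker_term (p\<^sup>2) a (z\<^sup>2) m) UNIV"
    by (subst infsum_reindex) (auto simp: inj_on_def o_def kronecker_term_def power_int_mult)
  finally show "kronecker_sum p a z + kronecker_sum p a (- z) = 2 * kronecker_sum (p\<^sup>2) a (z\<^sup>2)"
    by (simp add: infsum_cmult_right' kronecker_sum_def)
  have "kronecker_sum p a z - kronecker_sum p a (- z) =
      infsum (\<lambda>n. kronecker_term p a z n + - kronecker_term p a (- z) n) UNIV"
    unfolding kronecker_sum_def
    by (subst infsum_add[OF s1]) (auto simp: infsum_uminus summable_on_uminus s2)
  also have "\<dots> = infsum (\<lambda>n. 2 * kronecker_term p a z n) (range (\<lambda>m. 1 + 2 * m))"
    by (intro infsum_cong_neutral) (auto simp: neg elim!: oddE)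
  also have "\<dots> = infsum (\<lambda>m. (2 * z) * kronecker_term (p\<^sup>2) (a * p) (z\<^sup>2) m) UNIV"
    using p z0
    by (subst infsum_reindex)
      (auto simp: inj_on_def o_def kronecker_term_def power_int_mult power_int_add mult.assoc)
  finally show "kronecker_sum p a z - kronecker_sum p a (- z) = 2 * z * kronecker_sum (p\<^sup>2) (a * p) (z\<^sup>2)"
    by (simp add: infsum_cmult_right' kronecker_sum_def)
qed

text \<open>Apply Kronecker's identity to the four series of \<open>kronecker_sum_parity\<close>. The denominators combine
  because \<open>theta p z * theta p (-z) = theta (p^2) (z^2)\<close> and
  \<open>theta p a = theta (p^2) a * theta (p^2) (p a)\<close>.\<close>
lemma theta_addition:
  assumes p: "p \<noteq> 0" "norm p < 1" and z: "norm p < norm z" "norm z < 1"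
    and a: "a \<noteq> 0" "\<And>n::int. a * p powi n \<noteq> 1"
  defines "C \<equiv> (qpochhammer_inf p p)\<^sup>2" and "C2 \<equiv> (qpochhammer_inf (p\<^sup>2) (p\<^sup>2))\<^sup>2"
  shows "C * (theta p (a * z) * theta p (- z) + theta p (- (a * z)) * theta p z)
           = 2 * C2 * theta (p\<^sup>2) (a * z\<^sup>2) * theta (p\<^sup>2) (a * p)"
    and "C * (theta p (a * z) * theta p (- z) - theta p (- (a * z)) * theta p z)
           = 2 * z * C2 * theta (p\<^sup>2) (a * p * z\<^sup>2) * theta (p\<^sup>2) a"
proof -
  have p2: "p\<^sup>2 \<noteq> 0" "norm (p\<^sup>2) < 1" using p by (auto simp: norm_power power_less_one_iff)
  have z2: "norm (p\<^sup>2) < norm (z\<^sup>2)" "norm (z\<^sup>2) < 1"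
    using z by (auto simp: norm_power power_less_one_iff intro!: power_strict_mono)
  have a2: "a * (p\<^sup>2) powi n \<noteq> 1" for n :: int
    using a(2)[of "2 * n"] by (simp add: power_int_mult)
  have ap2: "a * p * (p\<^sup>2) powi n \<noteq> 1" for n :: int
    using a(2)[of "1 + 2 * n"] p by (simp add: power_int_mult power_int_add mult.assoc)
  have k1: "kronecker_sum p a z * theta p a * theta p z = C * theta p (a * z)"
    unfolding C_def using p z a by (rule kronecker_product)
  have k2: "kronecker_sum p a (- z) * theta p a * theta p (- z) = C * theta p (- (a * z))"
    unfolding C_def using kronecker_product[OF p _ _ a, of "- z"] z by simp
  have k3: "kronecker_sum (p\<^sup>2) a (z\<^sup>2) * theta (p\<^sup>2) a * theta (p\<^sup>2) (z\<^sup>2) = C2 * theta (p\<^sup>2) (a * z\<^sup>2)"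
    unfolding C2_def using p2 z2 a(1) a2 by (rule kronecker_product)
  have k4: "kronecker_sum (p\<^sup>2) (a * p) (z\<^sup>2) * theta (p\<^sup>2) (a * p) * theta (p\<^sup>2) (z\<^sup>2)
      = C2 * theta (p\<^sup>2) (a * p * z\<^sup>2)"
    unfolding C2_def using p2 z2 a(1) p(1) ap2 by (intro kronecker_product) auto
  note par = kronecker_sum_parity[OF p z a]
  note ta = theta_even_odd[OF p, of a]
  note tz = theta_mult_minus[OF p(2), of z]
  have "C * (theta p (a * z) * theta p (- z) + theta p (- (a * z)) * theta p z)
     = (kronecker_sum p a z + kronecker_sum p a (- z)) * theta p a * (theta p z * theta p (- z))"
    using k1 k2 by algebra
  also have "\<dots> = 2 * (kronecker_sum (p\<^sup>2) a (z\<^sup>2) * theta (p\<^sup>2) a * theta (p\<^sup>2) (z\<^sup>2)) * theta (p\<^sup>2) (a * p)"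
    unfolding par ta tz by (simp add: algebra_simps)
  finally show "C * (theta p (a * z) * theta p (- z) + theta p (- (a * z)) * theta p z)
           = 2 * C2 * theta (p\<^sup>2) (a * z\<^sup>2) * theta (p\<^sup>2) (a * p)"
    unfolding k3 by (simp add: algebra_simps)
  have "C * (theta p (a * z) * theta p (- z) - theta p (- (a * z)) * theta p z)
     = (kronecker_sum p a z - kronecker_sum p a (- z)) * theta p a * (theta p z * theta p (- z))"
    using k1 k2 by algebra
  also have "\<dots> = 2 * z * (kronecker_sum (p\<^sup>2) (a * p) (z\<^sup>2) * theta (p\<^sup>2) (a * p) * theta (p\<^sup>2) (z\<^sup>2))
      * theta (p\<^sup>2) a"
    unfolding par ta tz by (simp add: algebra_simps)
  finally show "C * (theta p (a * z) * theta p (- z) - theta p (- (a * z)) * theta p z)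
           = 2 * z * C2 * theta (p\<^sup>2) (a * p * z\<^sup>2) * theta (p\<^sup>2) a"
    unfolding k4 by (simp add: algebra_simps)
qed

section \<open>Dissection of the Kronecker series\<close>

text \<open>The product side contains the factor \<open>theta p p = 0\<close>.\<close>
lemma kronecker_sum_vanish:
  assumes p: "p \<noteq> 0" "norm p < 1" and z: "norm p < norm z" "norm z < 1" and a: "norm p < norm a" "norm a < 1"
    and "\<And>n::int. a * p powi n \<noteq> 1" "a * z = p"
  shows "kronecker_sum p a z = 0"
proof -
  have "a \<noteq> 0" using a by auto
  hence "kronecker_sum p a z * theta p a * theta p z = 0"
    using kronecker_product[OF p z] assms theta_self[OF p] by simp
  thus ?thesis using theta_nonzero[OF p z] theta_nonzero[OF p a] by simp
qed

text \<open>Expand each term by \<open>1/(1 - y) = (\<Sum>m<k. y^m) / (1 - y^k)\<close> with \<open>y = a p^n\<close> and sum over \<open>n\<close> for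
  every \<open>m\<close> separately. The bound \<open>m < k\<close> keeps the new arguments \<open>z p^m\<close> inside the annulus of
  convergence for the base \<open>p^k\<close>.\<close>
lemma kronecker_sum_dissection:
  assumes p: "p \<noteq> 0" "norm p < 1" and z: "norm p < norm z" "norm z < 1"
    and a: "a \<noteq> 0" "\<And>n::int. a ^ k * (p ^ k) powi n \<noteq> 1" and k: "k > 0"
  shows "kronecker_sum p a z = (\<Sum>m<k. a ^ m * kronecker_sum (p ^ k) (a ^ k) (z * p ^ m))"
proof -
  have z0: "z \<noteq> 0" using z by auto
  have pk: "norm (p ^ k) < 1" using p k by (rule_tac norm_power_lt_one)
  have hs: "((\<lambda>n. a ^ m * kronecker_term (p ^ k) (a ^ k) (z * p ^ m) n) has_sum
      a ^ m * kronecker_sum (p ^ k) (a ^ k) (z * p ^ m)) UNIV" if m: "m < k" for m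
  proof -
    have "norm (z * p ^ m) \<le> norm z * 1"
      unfolding norm_mult norm_power using p by (intro mult_left_mono power_le_one) auto
    hence 1: "norm (z * p ^ m) < 1" using z by simp
    have "norm (p ^ k) \<le> norm p ^ Suc m"
      unfolding norm_power using p m by (intro power_decreasing) auto
    also have "\<dots> < norm z * norm p ^ m" using z p by simp
    finally have 2: "norm (p ^ k) < norm (z * p ^ m)" by (simp add: norm_mult norm_power)
    have "kronecker_term (p ^ k) (a ^ k) (z * p ^ m) summable_on UNIV"
      by (rule abs_summable_summable[OF kronecker_term_summable]) (use p pk 1 2 a in auto)
    thus ?thesis unfolding kronecker_sum_def
      by (intro has_sum_cmult_right has_sum_infsum)
  qed
  have "((\<lambda>n. \<Sum>m\<in>M. a ^ m * kronecker_term (p ^ k) (a ^ k) (z * p ^ m) n) has_sum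
      (\<Sum>m\<in>M. a ^ m * kronecker_sum (p ^ k) (a ^ k) (z * p ^ m))) UNIV"
    if "finite M" "M \<subseteq> {..<k}" for M
    using that by (induction M rule: finite_induct) (auto intro!: has_sum_add hs)
  from this[of "{..<k}"] have *: "((\<lambda>n. \<Sum>m<k. a ^ m * kronecker_term (p ^ k) (a ^ k) (z * p ^ m) n) has_sum
      (\<Sum>m<k. a ^ m * kronecker_sum (p ^ k) (a ^ k) (z * p ^ m))) UNIV" by simp
  have "(\<Sum>m<k. a ^ m * kronecker_term (p ^ k) (a ^ k) (z * p ^ m) n) = kronecker_term p a z n" for n
  proof -
    define y where "y = a * p powi n"
    have pc: "(p ^ m) powi n = (p powi n) ^ m" for m
      by (simp add: power_int_power power_int_power' mult.commute)
    have yk: "y ^ k \<noteq> 1" using a(2)[of n] by (simp add: y_def power_mult_distrib pc)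
    hence y1: "y \<noteq> 1" by auto
    have "(\<Sum>m<k. a ^ m * kronecker_term (p ^ k) (a ^ k) (z * p ^ m) n)
        = (\<Sum>m<k. y ^ m * (z powi n / (1 - y ^ k)))"
      by (intro sum.cong refl)
         (simp add: kronecker_term_def y_def power_mult_distrib power_int_mult_distrib pc)
    also have "\<dots> = (\<Sum>m<k. y ^ m) * (z powi n / (1 - y ^ k))"
      by (rule sum_distrib_right[symmetric])
    also have "(\<Sum>m<k. y ^ m) = (1 - y ^ k) / (1 - y)"
      using y1 by (simp add: sum_gp_strict)
    also have "\<dots> * (z powi n / (1 - y ^ k)) = z powi n / (1 - y)"
      using yk by simp
    finally show ?thesis by (simp add: kronecker_term_def y_def)
  qed
  thus ?thesis using * unfolding kronecker_sum_def by (simp add: infsumI)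
qed

section \<open>Power series with a missing residue class\<close>

lemma sum_root_of_unity_powers:
  assumes "k > 0"
  defines "w \<equiv> exp (2 * of_real pi * \<i> / of_nat k)"
  shows "(\<Sum>j<k. (w ^ j) ^ s) = (if k dvd s then of_nat k else 0)"
proof -
  have *: "w ^ j = 1 \<longleftrightarrow> k dvd j" for j
    using complex_root_unity_eq_1[of k j] assms
    by (simp add: w_def exp_of_nat_mult[symmetric] mult_ac)
  have "(w ^ s) ^ k = 1" unfolding power_mult[symmetric] * by simp
  moreover have "(w ^ j) ^ s = (w ^ s) ^ j" for j by (simp add: power_mult[symmetric] mult.commute)
  ultimately show ?thesis using *[of s] by (simp add: sum_gp_strict)
qed

text \<open>The hypothesis says nothing at the origin; multiplying the series by \<open>x\<close> supplies that value, and
  then the uniqueness theorem for power series applies.\<close>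
lemma power_series_eq_zero_imp_coeff_zero:
  fixes b :: "nat \<Rightarrow> complex"
  assumes "\<And>x. x \<noteq> 0 \<Longrightarrow> norm x < 1 \<Longrightarrow> (\<lambda>n. b n * x ^ n) sums 0"
  shows "b n = 0"
proof -
  \<comment> \<open>The coefficients of \<open>x * (\<Sum>n. b n * x^n)\<close>.\<close>
  define F where "F = Abs_fps (\<lambda>n. case n of 0 \<Rightarrow> 0 | Suc m \<Rightarrow> b m)"
  have s: "(\<lambda>n. fps_nth F n * x ^ n) sums 0" if "norm x < 1" for x
  proof (cases "x = 0")
    case True
    thus ?thesis by (simp add: F_def)
  next
    case False
    hence "(\<lambda>n. x * (b n * x ^ n)) sums (x * 0)" using assms that by (intro sums_mult) auto
    hence "(\<lambda>n. fps_nth F (Suc n) * x ^ Suc n) sums 0" by (simp add: F_def mult_ac)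
    thus ?thesis by (subst (asm) sums_Suc_iff) (simp add: F_def)
  qed
  have "fps_conv_radius F \<ge> norm (1/2 :: complex)"
    unfolding fps_conv_radius_def using s[of "1/2"] by (intro conv_radius_geI) (simp add: sums_iff)
  hence "fps_conv_radius F > 0" by (rule less_le_trans[rotated]) simp
  moreover have "\<forall>\<^sub>F x in nhds 0. eval_fps F x = eval_fps 0 x"
    unfolding eventually_nhds_metric
    by (rule exI[of _ 1]) (use s in \<open>auto simp: eval_fps_def sums_iff\<close>)
  ultimately have "F = 0" by (intro eval_fps_eqD) auto
  hence "fps_nth F (Suc n) = 0" by simp
  thus ?thesis by (simp add: F_def)
qed

text \<open>With a primitive \<open>k\<close>-th root of unity \<open>w\<close>, averaging \<open>w^(-n j) * f (w^j x)\<close> over \<open>j\<close> extracts from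
  the power series the exponents congruent to \<open>n\<close>. The functions \<open>e i (x^k)\<close> are invariant under
  \<open>x \<mapsto> w^j x\<close>, so on the other side the same average multiplies the summand for \<open>i\<close> by the sum of
  \<open>w^((d i - n) j)\<close> over \<open>j\<close>, which is zero.\<close>
lemma coeff_zero_if_residue_class_missing:
  fixes c :: "nat \<Rightarrow> complex" and f :: "complex \<Rightarrow> complex" and e :: "'i \<Rightarrow> complex \<Rightarrow> complex"
  assumes k: "k > 0"
    and sums: "\<And>x. norm x < 1 \<Longrightarrow> (\<lambda>n. c n * x ^ n) sums f x"
    and f: "\<And>x. x \<noteq> 0 \<Longrightarrow> norm x < 1 \<Longrightarrow> f x = (\<Sum>i\<in>I. x ^ d i * e i (x ^ k))"
    and d: "\<And>i. i \<in> I \<Longrightarrow> d i mod k \<noteq> n mod k"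
  shows "c n = 0"
proof -
  define w where "w = exp (2 * of_real pi * \<i> / of_nat k)"
  \<comment> \<open>The exponent \<open>s\<close> is \<open>-n\<close> modulo \<open>k\<close>, kept a natural number.\<close>
  define s where "s = k - n mod k"
  note root_sum = sum_root_of_unity_powers[OF k, folded w_def]
  have "w ^ k = exp (of_nat k * (2 * of_real pi * \<i> / of_nat k))"
    unfolding w_def by (rule exp_of_nat_mult[symmetric])
  also have "\<dots> = 1" using k by simp
  finally have "w ^ k = 1" .
  hence wk: "(w ^ j) ^ k = 1" for j by (metis power_mult mult.commute power_one)
  have "norm w = 1"
    unfolding w_def using norm_exp_i_times[of "2 * pi / k"] by (simp add: mult_ac)
  hence w1: "norm (w ^ j) = 1" for j by (simp add: norm_power)
  hence w0: "w ^ j \<noteq> 0" for j using w1[of j] by force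
  have dvd: "k dvd s + m \<longleftrightarrow> m mod k = n mod k" for m
  proof -
    have "n mod k \<le> k" using k by (simp add: less_imp_le)
    hence "int s = int k - int (n mod k)" by (simp add: s_def of_nat_diff)
    moreover have "int n = int k * int (n div k) + int (n mod k)"
      by (metis mult_div_mod_eq of_nat_add of_nat_mult)
    ultimately have "int (s + m) = (int m - int n) + int k * (1 + int (n div k))"
      by (simp only: of_nat_add distrib_left)
    hence "int k dvd int (s + m) \<longleftrightarrow> int k dvd int m - int n" by (simp only: dvd_add_left_iff[OF dvd_triv_left])
    thus ?thesis by (metis int_dvd_int_iff mod_eq_dvd_iff of_nat_eq_iff of_nat_mod)
  qed
  have "c n * (\<Sum>j<k. (w ^ j) ^ (s + n)) = 0"
  proof (rule power_series_eq_zero_imp_coeff_zero[where b = "\<lambda>n. c n * (\<Sum>j<k. (w ^ j) ^ (s + n))"])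
    fix x :: complex assume x: "x \<noteq> 0" "norm x < 1"
    have filtered: "(\<lambda>n. \<Sum>j<k. (w ^ j) ^ s * (c n * (w ^ j * x) ^ n)) sums (\<Sum>j<k. (w ^ j) ^ s * f (w ^ j * x))"
      using x w1 by (intro sums_sum sums_mult sums) (simp add: norm_mult)
    have terms: "(\<lambda>n. \<Sum>j<k. (w ^ j) ^ s * (c n * (w ^ j * x) ^ n)) =
        (\<lambda>n. c n * (\<Sum>j<k. (w ^ j) ^ (s + n)) * x ^ n)"
      by (intro ext) (simp add: sum_distrib_left sum_distrib_right power_add power_mult_distrib mult_ac)
    have "(\<Sum>j<k. (w ^ j) ^ s * f (w ^ j * x)) =
        (\<Sum>j<k. \<Sum>i\<in>I. (w ^ j) ^ (s + d i) * (x ^ d i * e i (x ^ k)))"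
      using x w0 w1 wk
      by (simp add: f norm_mult sum_distrib_left power_add power_mult_distrib mult_ac)
    also have "\<dots> = (\<Sum>i\<in>I. (\<Sum>j<k. (w ^ j) ^ (s + d i)) * (x ^ d i * e i (x ^ k)))"
      by (subst sum.swap) (simp add: sum_distrib_right)
    also have "\<dots> = 0"
      unfolding root_sum dvd using d by (intro sum.neutral) auto
    finally show "(\<lambda>n. c n * (\<Sum>j<k. (w ^ j) ^ (s + n)) * x ^ n) sums 0"
      using filtered unfolding terms by simp
  qed
  thus ?thesis unfolding root_sum dvd using k by simp
qed

section \<open>The two products modulo five\<close>

lemma theta_power_nonzero:
  fixes q :: complex
  assumes "q \<noteq> 0" "norm q < 1" "0 < i" "i < k"
  shows "theta (q ^ k) (q ^ i) \<noteq> 0"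
  using assms by (intro theta_nonzero norm_power_lt_one norm_power_strict_decreasing) auto

lemma theta_even_odd_power:
  fixes q :: complex
  assumes "q \<noteq> 0" "norm q < 1"
  shows "theta (q ^ 5) (q ^ i) = theta (q ^ 10) (q ^ i) * theta (q ^ 10) (q ^ (5 + i))"
  using theta_even_odd[of "q ^ 5" "q ^ i"] norm_power_lt_one[of q 5] assms
  by (simp add: power_add flip: power_mult)

lemma theta_mult_minus_power:
  fixes q :: complex
  assumes "norm q < 1"
  shows "theta (q ^ 5) (q ^ i) * theta (q ^ 5) (- (q ^ i)) = theta (q ^ 10) (q ^ (i * 2))"
  using theta_mult_minus[of "q ^ 5" "q ^ i"] norm_power_lt_one[of q 5] assms
  by (simp flip: power_mult)

lemma theta_reflect_power:
  fixes q :: complex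
  assumes "q \<noteq> 0" "i + j = k"
  shows "theta (q ^ k) (q ^ i) = theta (q ^ k) (q ^ j)"
  using assms by (intro theta_reflect) (auto simp flip: power_add)

text \<open>Multiply the first two factors by \<open>theta (q^5) q * theta (q^5) (q^2)\<close>. Pairing \<open>x\<close> with \<open>-x\<close> turns
  the result into \<open>theta (q^10) (q^2) * theta (q^10) (q^4)\<close>; on the other hand, splitting the two
  multipliers to the base \<open>q^10\<close> gives those same two values times
  \<open>theta (q^10) q * theta (q^10) (q^3)\<close>.\<close>
lemma theta_five_ten_product:
  fixes q :: complex
  assumes q: "q \<noteq> 0" "norm q < 1"
  shows "theta (q ^ 5) (- q) * theta (q ^ 5) (- (q ^ 2)) * theta (q ^ 10) q * theta (q ^ 10) (q ^ 3) = 1"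
proof -
  have square: "theta (q ^ 5) q * theta (q ^ 5) (- q) = theta (q ^ 10) (q ^ 2)"
      "theta (q ^ 5) (q ^ 2) * theta (q ^ 5) (- (q ^ 2)) = theta (q ^ 10) (q ^ 4)"
    using theta_mult_minus_power[OF q(2), of 1] theta_mult_minus_power[OF q(2), of 2] by simp_all
  have split: "theta (q ^ 5) q = theta (q ^ 10) q * theta (q ^ 10) (q ^ 4)"
      "theta (q ^ 5) (q ^ 2) = theta (q ^ 10) (q ^ 2) * theta (q ^ 10) (q ^ 3)"
    using theta_even_odd_power[OF q, of 1] theta_reflect_power[OF q(1), of 4 6 10]
      theta_even_odd_power[OF q, of 2] theta_reflect_power[OF q(1), of 3 7 10] by simp_all
  have "(theta (q ^ 10) (q ^ 2) * theta (q ^ 10) (q ^ 4)) *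
     (theta (q ^ 5) (- q) * theta (q ^ 5) (- (q ^ 2)) * theta (q ^ 10) q * theta (q ^ 10) (q ^ 3)) =
     (theta (q ^ 5) q * theta (q ^ 5) (- q)) * (theta (q ^ 5) (q ^ 2) * theta (q ^ 5) (- (q ^ 2)))"
    unfolding split by (simp only: mult_ac)
  also have "\<dots> = (theta (q ^ 10) (q ^ 2) * theta (q ^ 10) (q ^ 4)) * 1"
    unfolding square by simp
  finally have "(theta (q ^ 10) (q ^ 2) * theta (q ^ 10) (q ^ 4)) *
     (theta (q ^ 5) (- q) * theta (q ^ 5) (- (q ^ 2)) * theta (q ^ 10) q * theta (q ^ 10) (q ^ 3)) =
     (theta (q ^ 10) (q ^ 2) * theta (q ^ 10) (q ^ 4)) * 1" .
  moreover have "theta (q ^ 10) (q ^ 2) * theta (q ^ 10) (q ^ 4) \<noteq> 0"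
    using theta_power_nonzero[OF q] by simp
  ultimately show ?thesis by (simp only: mult_cancel_left simp_thms)
qed

definition G1_prod :: "complex \<Rightarrow> complex" where
  "G1_prod q = (theta (q ^ 5) (- q))\<^sup>2 * theta (q ^ 10) (q ^ 4)"

definition H1_prod :: "complex \<Rightarrow> complex" where
  "H1_prod q = (theta (q ^ 5) (- (q ^ 2)))\<^sup>2 * theta (q ^ 10) (q ^ 2)"

text \<open>The factor, as a function of \<open>Q = q^5\<close>, that accompanies the Kronecker series in \<open>G \<plusminus> H\<close>.\<close>
definition base5_factor :: "complex \<Rightarrow> complex" where
  "base5_factor Q = 2 * theta (Q\<^sup>2) Q / (qpochhammer_inf Q Q)\<^sup>2"

text \<open>The addition formula with \<open>p = q^5\<close> and \<open>a = z = q\<close> evaluates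
  \<open>theta p (q^2) * theta p (-q) \<plusminus> theta p (-q^2) * theta p q\<close>. After multiplication with the
  common factor, one theta quotient to the base \<open>q^10\<close> remains, and Kronecker's identity with
  \<open>z = q^5\<close> expands it.\<close>
lemma G1_H1_kronecker:
  assumes q: "q \<noteq> 0" "norm q < 1"
  shows "G1_prod q + H1_prod q = base5_factor (q ^ 5) * kronecker_sum (q ^ 10) q (q ^ 5)"
    and "G1_prod q - H1_prod q = q * base5_factor (q ^ 5) * kronecker_sum (q ^ 10) (q ^ 3) (q ^ 5)"
proof -
  let ?p = "q ^ 5"
  have p: "?p \<noteq> 0" "norm ?p < 1" using q norm_power_lt_one by auto
  have pp: "?p\<^sup>2 = q ^ 10" by (simp flip: power_mult)
  define C where "C = (qpochhammer_inf ?p ?p)\<^sup>2"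
  define D where "D = (qpochhammer_inf (q ^ 10) (q ^ 10))\<^sup>2"
  define T where "T = theta ?p (- q) * theta ?p (- (q ^ 2))"
  have "?p * ?p ^ n \<noteq> 1" for n
    using power_eq_one_imp_zero[OF p(2), of "Suc n"] by auto
  hence C0: "C \<noteq> 0" unfolding C_def using qpochhammer_inf_nonzero[OF p(2)] by simp
  have T: "T * theta (q ^ 10) q * theta (q ^ 10) (q ^ 3) = 1"
    unfolding T_def by (rule theta_five_ten_product[OF q])
  have nz: "theta (q ^ 10) q \<noteq> 0" "theta (q ^ 10) (q ^ 3) \<noteq> 0" using T by auto
  have Kp: "base5_factor ?p = 2 * theta (q ^ 10) (q ^ 5) / C" by (simp add: base5_factor_def C_def pp)

  have "theta ?p (q ^ 2) * theta ?p (- (q ^ 2)) = theta (q ^ 10) (q ^ 4)"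
    using theta_mult_minus_power[OF q(2), of 2] by simp
  hence G1: "G1_prod q = T * (theta ?p (q ^ 2) * theta ?p (- q))"
    by (simp add: G1_prod_def T_def power2_eq_square mult_ac)
  have "theta ?p q * theta ?p (- q) = theta (q ^ 10) (q ^ 2)"
    using theta_mult_minus_power[OF q(2), of 1] by simp
  hence H1: "H1_prod q = T * (theta ?p (- (q ^ 2)) * theta ?p q)"
    by (simp add: H1_prod_def T_def power2_eq_square mult_ac)

  have zn: "norm ?p < norm q" using norm_power_strict_decreasing[OF q, of 1 5] by simp
  have an: "q * ?p powi n \<noteq> 1" for n using power_int_progression_ne_one[OF q, of 5 1 n] by simp
  note add = theta_addition[OF p zn q(2) q(1) an, unfolded pp, folded C_def D_def]
  have "q * q\<^sup>2 = q ^ 3" "q * ?p = q ^ 6" "q ^ 6 * q\<^sup>2 = q ^ 8" "q * q = q\<^sup>2"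
    by (simp_all flip: power_Suc power_add power2_eq_square)
  note add = add[unfolded this]
  have add1: "C * (G1_prod q + H1_prod q) = T * (2 * D * theta (q ^ 10) (q ^ 3) * theta (q ^ 10) (q ^ 6))"
    unfolding G1 H1 using add(1) by algebra
  have add2: "C * (G1_prod q - H1_prod q) = T * (2 * q * D * theta (q ^ 10) (q ^ 8) * theta (q ^ 10) q)"
    unfolding G1 H1 using add(2) by algebra

  have k1: "kronecker_sum (q ^ 10) q (q ^ 5) * theta (q ^ 10) q * theta (q ^ 10) (q ^ 5)
      = D * theta (q ^ 10) (q ^ 6)"
    using kronecker_product[of "q ^ 10" "q ^ 5" q] q norm_power_lt_one[OF q(2)]
      norm_power_strict_decreasing[OF q, of 5 10] power_int_progression_ne_one[OF q, of 10 1]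
    by (simp add: D_def flip: power_Suc)
  have k2: "kronecker_sum (q ^ 10) (q ^ 3) (q ^ 5) * theta (q ^ 10) (q ^ 3) * theta (q ^ 10) (q ^ 5)
      = D * theta (q ^ 10) (q ^ 8)"
    using kronecker_product[of "q ^ 10" "q ^ 5" "q ^ 3"] q norm_power_lt_one[OF q(2)]
      norm_power_strict_decreasing[OF q, of 5 10] power_int_progression_ne_one[OF q, of 10 3]
    by (simp add: D_def flip: power_add)

  have "theta (q ^ 10) q * (C * (G1_prod q + H1_prod q)) = 2 * D * theta (q ^ 10) (q ^ 6)"
    unfolding add1 using T by algebra
  also have "\<dots> = theta (q ^ 10) q * (2 * theta (q ^ 10) (q ^ 5) * kronecker_sum (q ^ 10) q (q ^ 5))"
    using k1 by algebra
  finally have "C * (G1_prod q + H1_prod q) = 2 * theta (q ^ 10) (q ^ 5) * kronecker_sum (q ^ 10) q (q ^ 5)"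
    using nz by simp
  thus "G1_prod q + H1_prod q = base5_factor ?p * kronecker_sum (q ^ 10) q (q ^ 5)"
    using C0 by (simp add: Kp field_simps)

  have "theta (q ^ 10) (q ^ 3) * (C * (G1_prod q - H1_prod q)) = 2 * q * D * theta (q ^ 10) (q ^ 8)"
    unfolding add2 using T by algebra
  also have "\<dots> = theta (q ^ 10) (q ^ 3) * (2 * q * theta (q ^ 10) (q ^ 5) * kronecker_sum (q ^ 10) (q ^ 3) (q ^ 5))"
    using k2 by algebra
  finally have "C * (G1_prod q - H1_prod q) = 2 * q * theta (q ^ 10) (q ^ 5) * kronecker_sum (q ^ 10) (q ^ 3) (q ^ 5)"
    using nz by simp
  thus "G1_prod q - H1_prod q = q * base5_factor ?p * kronecker_sum (q ^ 10) (q ^ 3) (q ^ 5)"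
    using C0 by (simp add: Kp field_simps)
qed

lemma kronecker_sum_vanish_power:
  assumes Q: "Q \<noteq> 0" "norm Q < 1" and "i + j = k" "0 < i" "0 < j"
  shows "kronecker_sum (Q ^ k) (Q ^ i) (Q ^ j) = 0"
proof (rule kronecker_sum_vanish)
  show "Q ^ i * (Q ^ k) powi n \<noteq> 1" for n
    using assms by (intro power_int_progression_ne_one Q) (auto dest: dvd_imp_le)
qed (use assms in \<open>auto intro!: norm_power_lt_one norm_power_strict_decreasing simp flip: power_add\<close>)

lemma kronecker_sum_five_dissection:
  assumes q: "q \<noteq> 0" "norm q < 1" and i: "\<not> 10 dvd i"
  shows "kronecker_sum (q ^ 10) (q ^ i) (q ^ 5) =
     (\<Sum>m<5. q ^ (i * m) * kronecker_sum ((q ^ 5) ^ 10) ((q ^ 5) ^ i) ((q ^ 5) ^ (1 + 2 * m)))"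
proof -
  have e: "(q ^ 10) ^ 5 = (q ^ 5) ^ 10" "(q ^ i) ^ 5 = (q ^ 5) ^ i" by (simp_all flip: power_mult add: mult.commute)
  have z: "(q ^ i) ^ m = q ^ (i * m)" "q ^ 5 * (q ^ 10) ^ m = (q ^ 5) ^ (1 + 2 * m)" for m
    by (simp_all add: power_mult[symmetric] power_add[symmetric] distrib_left)
  have q5: "q ^ 5 \<noteq> 0" "norm (q ^ 5) < 1" using q norm_power_lt_one by auto
  have "kronecker_sum (q ^ 10) (q ^ i) (q ^ 5) =
     (\<Sum>m<5. (q ^ i) ^ m * kronecker_sum ((q ^ 10) ^ 5) ((q ^ i) ^ 5) (q ^ 5 * (q ^ 10) ^ m))"
  proof (rule kronecker_sum_dissection)
    show "(q ^ i) ^ 5 * ((q ^ 10) ^ 5) powi n \<noteq> 1" for n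
      unfolding e using q5 i by (rule power_int_progression_ne_one)
  qed (use q in \<open>auto intro!: norm_power_lt_one norm_power_strict_decreasing\<close>)
  thus ?thesis unfolding e unfolding z .
qed

theorem corollary1p5:
  fixes g1 h1 :: "nat \<Rightarrow> complex"
  assumes g1: "\<And>q :: complex. norm q < 1 \<Longrightarrow>
      (\<lambda>n. g1 n * q ^ n) sums
        ((qpochhammer_inf_list [- q, - (q ^ 4)] (q ^ 5))\<^sup>2 *
          qpochhammer_inf_list [q ^ 4, q ^ 6] (q ^ 10))"
    and h1: "\<And>q :: complex. norm q < 1 \<Longrightarrow>
      (\<lambda>n. h1 n * q ^ n) sums
        ((qpochhammer_inf_list [- (q ^ 2), - (q ^ 3)] (q ^ 5))\<^sup>2 *
          qpochhammer_inf_list [q ^ 2, q ^ 8] (q ^ 10))"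
  shows "\<forall>n :: nat. g1 (5 * n) = h1 (5 * n) \<and> g1 (5 * n + 4) = - h1 (5 * n + 4)"
proof (intro allI conjI)
  fix n :: nat
  define g where "g q = (\<Sum>n. g1 n * q ^ n)" for q
  define h where "h q = (\<Sum>n. h1 n * q ^ n)" for q
  have gs: "(\<lambda>n. g1 n * q ^ n) sums g q" and hs: "(\<lambda>n. h1 n * q ^ n) sums h q" if "norm q < 1" for q
    using g1[OF that] h1[OF that] by (simp_all add: g_def h_def sums_iff)
  have quot: "q ^ 5 / - q = - (q ^ 4)" "q ^ 5 / - (q ^ 2) = - (q ^ 3)" "q ^ 10 / q ^ 4 = q ^ 6" "q ^ 10 / q ^ 2 = q ^ 8"
    if "q \<noteq> 0" for q :: complex
    using that by (simp_all add: field_simps flip: power_Suc power_add)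
  have gG: "g q = G1_prod q" and hH: "h q = H1_prod q" if "q \<noteq> 0" "norm q < 1" for q
    using sums_unique2[OF gs[OF that(2)] g1[OF that(2)]] sums_unique2[OF hs[OF that(2)] h1[OF that(2)]]
    unfolding G1_prod_def H1_prod_def theta_def quot[OF that(1)] by (simp_all add: qpochhammer_inf_list_def)

  let ?e = "\<lambda>i m Q. base5_factor Q * kronecker_sum (Q ^ 10) (Q ^ i) (Q ^ (1 + 2 * m))"
  \<comment> \<open>The part with \<open>m = 4\<close> vanishes, so \<open>G + H\<close> only has parts with residues \<open>0, 1, 2, 3\<close>.\<close>
  have "g1 (5 * n + 4) + h1 (5 * n + 4) = 0"
  proof (rule coeff_zero_if_residue_class_missing[where k = 5 and I = "{..<5} - {4}" and d = "\<lambda>m. m" and e = "?e 1"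
        and f = "\<lambda>q. g q + h q"])
    fix q :: complex assume q: "norm q < 1"
    show "(\<lambda>n. (g1 n + h1 n) * q ^ n) sums (g q + h q)"
      using sums_add[OF gs hs, OF q q] by (simp add: distrib_right)
    assume q0: "q \<noteq> 0"
    have "kronecker_sum ((q ^ 5) ^ 10) ((q ^ 5) ^ 1) ((q ^ 5) ^ (1 + 2 * 4)) = 0"
      using q q0 by (intro kronecker_sum_vanish_power norm_power_lt_one) auto
    moreover have "kronecker_sum (q ^ 10) q (q ^ 5) =
       (\<Sum>m<5. q ^ m * kronecker_sum ((q ^ 5) ^ 10) ((q ^ 5) ^ 1) ((q ^ 5) ^ (1 + 2 * m)))"
      using kronecker_sum_five_dissection[OF q0 q, of 1] by simp
    ultimately have "kronecker_sum (q ^ 10) q (q ^ 5) =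
       (\<Sum>m\<in>{..<5}-{4}. q ^ m * kronecker_sum ((q ^ 5) ^ 10) ((q ^ 5) ^ 1) ((q ^ 5) ^ (1 + 2 * m)))"
      by (subst sum_diff1) auto
    thus "g q + h q = (\<Sum>m\<in>{..<5}-{4}. q ^ m * ?e 1 m (q ^ 5))"
      unfolding gG[OF q0 q] hH[OF q0 q] G1_H1_kronecker[OF q0 q]
      by (simp only: sum_distrib_left mult_ac)
  qed auto
  thus "g1 (5 * n + 4) = - h1 (5 * n + 4)" by (simp add: eq_neg_iff_add_eq_0)

  \<comment> \<open>The part with \<open>m = 3\<close> vanishes; the others have the residues \<open>1, 4, 2, 3\<close> of \<open>1 + 3 m\<close>.\<close>
  have "g1 (5 * n) - h1 (5 * n) = 0"
  proof (rule coeff_zero_if_residue_class_missing[where k = 5 and I = "{..<5} - {3}" and d = "\<lambda>m. 1 + 3 * m" and e = "?e 3"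
        and f = "\<lambda>q. g q - h q"])
    fix q :: complex assume q: "norm q < 1"
    show "(\<lambda>n. (g1 n - h1 n) * q ^ n) sums (g q - h q)"
      using sums_diff[OF gs hs, OF q q] by (simp add: left_diff_distrib)
    assume q0: "q \<noteq> 0"
    have "kronecker_sum ((q ^ 5) ^ 10) ((q ^ 5) ^ 3) ((q ^ 5) ^ (1 + 2 * 3)) = 0"
      using q q0 by (intro kronecker_sum_vanish_power norm_power_lt_one) auto
    moreover have "kronecker_sum (q ^ 10) (q ^ 3) (q ^ 5) =
       (\<Sum>m<5. q ^ (3 * m) * kronecker_sum ((q ^ 5) ^ 10) ((q ^ 5) ^ 3) ((q ^ 5) ^ (1 + 2 * m)))"
      using kronecker_sum_five_dissection[OF q0 q, of 3] by simp
    ultimately have "kronecker_sum (q ^ 10) (q ^ 3) (q ^ 5) =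
       (\<Sum>m\<in>{..<5}-{3}. q ^ (3 * m) * kronecker_sum ((q ^ 5) ^ 10) ((q ^ 5) ^ 3) ((q ^ 5) ^ (1 + 2 * m)))"
      by (subst sum_diff1) auto
    thus "g q - h q = (\<Sum>m\<in>{..<5}-{3}. q ^ (1 + 3 * m) * ?e 3 m (q ^ 5))"
      unfolding gG[OF q0 q] hH[OF q0 q] G1_H1_kronecker[OF q0 q] power_add power_one_right
      by (simp only: sum_distrib_left mult_ac)
  next
    fix m assume "m \<in> {..<5::nat} - {3}"
    hence "m \<in> {0, 1, 2, 4}" by auto
    thus "(1 + 3 * m) mod 5 \<noteq> (5 * n) mod 5" by auto
  qed auto
  thus "g1 (5 * n) = h1 (5 * n)" by simp
qed

end
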